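(* Let $G=(V,E,w)$ be a finite weighted directed graph which is connected to its nonempty boundary $\partial V$. Let $F$ be a (generalized) $p$-harmonious equation on $G$, i.e. for interior vertices $x\in V\setminus\partial V$, $$F(u)(x)=w_+(x)\,\|\nabla u(x)\|^{+}+w_-(x)\,\|\nabla u(x)\|^{-}+f(x,\nabla u(x)),$$ where $w_+$ and $w_-$ are strictly positive functions on $V\setminus\partial V$ and $f$ is elliptic and homogeneous. Suppose $u,v:V\to\mathbb{R}$ are solutions, i.e. $F(u)(x)=0$ and $F(v)(x)=0$ for all $x\in V\setminus\partial V$. If $u(x)\le v(x)$ for all $x\in\partial V$, then $u(x)\le v(x)$ for all $x\in V$.
   Context: $G=(V,E,w)$ is a finite weighted directed graph: $V$ is a finite set of vertices, $E\subset V\times V$ is a set of oriented edges $e_{xy}=(x,y)$ from $x$ to $y$, and $w$ assigns a weight $w_{xy}>0$ to each edge $e_{xy}$ joining different vertices. A nonempty subset $\partial V\subset V$ is fixed, called the boundary; vertices of $V\setminus\partial V$ are called interior. A vertex $y\neq x$ is a neighbor of $x$ if there is an edge from $x$ to $y$; $d(x)$ is the number of neighbors of $x$, and it is assumed that $d(x)\ge 1$ for every interior $x$. For each $x$ an ordering $y_1,\dots,y_{d(x)}$ of the neighbors of $x$ is fixed. The graph is connected to the boundary if for every $x\in V$ there is a $y\in\partial V$ and a finite path from $x$ to $y$ proceeding from each vertex to one of its neighbors (i.e. following directed edges). For $u:V\to\mathbb{R}$ and interior $x$, the gradient is $\nabla u(x)=\big(w_{xy_1}(u(y_1)-u(x)),\dots,w_{xy_{d(x)}}(u(y_{d(x)})-u(x))\big)\in\mathbb{R}^{d(x)}$;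 $\|\nabla u(x)\|^{+}=\max_{1\le i\le d(x)}w_{xy_i}(u(y_i)-u(x))$ and $\|\nabla u(x)\|^{-}=\min_{1\le i\le d(x)}w_{xy_i}(u(y_i)-u(x))$. For vectors, $\mathbf{p}\le\mathbf{q}$ means $p_i\le q_i$ for all $i$; $\min(\mathbf{p})$ and $\max(\mathbf{p})$ denote the smallest and largest components. A real-valued function $f(x,\mathbf{p})$, defined for interior $x$ and $\mathbf{p}\in\mathbb{R}^{d(x)}$, is elliptic if $\mathbf{p}\le\mathbf{q}$ implies $f(x,\mathbf{p})\le f(x,\mathbf{q})$ for all interior $x$ and $\mathbf{p},\mathbf{q}\in\mathbb{R}^{d(x)}$. An elliptic $f$ is homogeneous if there is a function $w_0:V\setminus\partial V\to[0,\infty)$ with $w_0(x)\min(\mathbf{p})\le f(x,\mathbf{p})\le w_0(x)\max(\mathbf{p})$ for all interior $x$ and all $\mathbf{p}\in\mathbb{R}^{d(x)}$. *)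

theory Defs
  imports Complex_Main "Graph_Theory.Pair_Digraph"
begin

text \<open>
  Self-loops are permitted as edges; they carry no condition on the weight and
  do not contribute to the set of neighbors.
\<close>

definition neighbors :: "'v pair_pre_digraph \<Rightarrow> 'v \<Rightarrow> 'v set" where
  "neighbors G x = {y. y \<noteq> x \<and> (x, y) \<in> parcs G}"

definition degree :: "'v pair_pre_digraph \<Rightarrow> 'v \<Rightarrow> nat" where
  "degree G x = card (neighbors G x)"

definition interior_vertices :: "'v pair_pre_digraph \<Rightarrow> 'v set \<Rightarrow> 'v set" where
  "interior_vertices G bd = pverts G - bd"

text \<open>
  \<open>bd\<close> is the boundary, and \<open>nbrs x\<close> is the fixed ordering of the neighbors of \<open>x\<close>,
  as a list without repetitions.  The values of \<open>w\<close> off the edges are irrelevant.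
\<close>

locale weighted_digraph_with_boundary = pair_fin_digraph G
  for G :: "'v pair_pre_digraph" +
  fixes w :: "'v \<Rightarrow> 'v \<Rightarrow> real"
    and bd :: "'v set"
    and nbrs :: "'v \<Rightarrow> 'v list"
  assumes weight_pos: "\<And>x y. (x, y) \<in> parcs G \<Longrightarrow> x \<noteq> y \<Longrightarrow> w x y > 0"
    and boundary_subset: "bd \<subseteq> pverts G"
    and boundary_nonempty: "bd \<noteq> {}"
    and degree_ge_1: "\<And>x. x \<in> interior_vertices G bd \<Longrightarrow> degree G x \<ge> 1"
    and distinct_nbrs: "\<And>x. x \<in> pverts G \<Longrightarrow> distinct (nbrs x)"
    and set_nbrs: "\<And>x. x \<in> pverts G \<Longrightarrow> set (nbrs x) = neighbors G x"

definition connected_to_boundary :: "'v pair_pre_digraph \<Rightarrow> 'v set \<Rightarrow> bool" where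
  "connected_to_boundary G bd \<longleftrightarrow>
     (\<forall>x\<in>pverts G. \<exists>y\<in>bd. (\<lambda>a b. b \<in> neighbors G a)\<^sup>*\<^sup>* x y)"

text \<open>
  A vector in $\mathbb{R}^{d(x)}$ is a real list of length \<open>degree G x\<close>, since the dimension
  depends on the vertex; the componentwise order is \<open>list_all2 (\<le>)\<close>.
\<close>

definition gradient ::
  "('v \<Rightarrow> 'v \<Rightarrow> real) \<Rightarrow> ('v \<Rightarrow> 'v list) \<Rightarrow> ('v \<Rightarrow> real) \<Rightarrow> 'v \<Rightarrow> real list" where
  "gradient w nbrs u x = map (\<lambda>y. w x y * (u y - u x)) (nbrs x)"

definition vec_max :: "real list \<Rightarrow> real" where
  "vec_max p = Max (set p)"

definition vec_min :: "real list \<Rightarrow> real" where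
  "vec_min p = Min (set p)"

definition elliptic ::
  "'v pair_pre_digraph \<Rightarrow> 'v set \<Rightarrow> ('v \<Rightarrow> real list \<Rightarrow> real) \<Rightarrow> bool" where
  "elliptic G bd f \<longleftrightarrow>
     (\<forall>x\<in>interior_vertices G bd. \<forall>p q.
        length p = degree G x \<longrightarrow> length q = degree G x \<longrightarrow>
        list_all2 (\<le>) p q \<longrightarrow> f x p \<le> f x q)"

definition homogeneous ::
  "'v pair_pre_digraph \<Rightarrow> 'v set \<Rightarrow> ('v \<Rightarrow> real list \<Rightarrow> real) \<Rightarrow> bool" where
  "homogeneous G bd f \<longleftrightarrow>
     (\<exists>w0 :: 'v \<Rightarrow> real. \<forall>x\<in>interior_vertices G bd. w0 x \<ge> 0 \<and>
        (\<forall>p. length p = degree G x \<longrightarrow>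
           w0 x * vec_min p \<le> f x p \<and> f x p \<le> w0 x * vec_max p))"

end

theory Submission
  imports Defs
begin

text \<open>
  The argument is a maximum principle on the set \<open>A\<close> where \<open>u - v\<close> attains its maximum \<open>M\<close> over
  \<open>V\<close>. Suppose \<open>M > 0\<close>; then \<open>A\<close> misses the boundary. At \<open>x \<in> A\<close> we have \<open>\<nabla>u(x) \<le> \<nabla>v(x)\<close>
  componentwise, so each of the three terms of \<open>F(u)(x) = 0\<close> is at most the matching term of
  \<open>F(v)(x) = 0\<close>. Hence the terms agree, and since \<open>w\<^sub>+\<close> and \<open>w\<^sub>-\<close> are strictly positive, the two
  gradients have the same maximum and the same minimum (\<open>vec_extrema_eq_of_le\<close>).

  Equality of these extrema does not by itself put all neighbors of \<open>x\<close> into \<open>A\<close>. The neighbor \<open>y\<close>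
  in the direction of steepest ascent of \<open>u\<close> does belong to \<open>A\<close>, however: the component of
  \<open>\<nabla>v(x)\<close> at \<open>y\<close> is squeezed between that of \<open>\<nabla>u(x)\<close> and the common maximum. So look at the set
  \<open>B\<close> of those \<open>x \<in> A\<close> where \<open>u\<close> is largest on \<open>A\<close>. There the ascent cannot be strict, i.e.
  \<open>max (\<nabla>u(x)) \<le> 0\<close>, and homogeneity then makes all three terms of \<open>F(u)(x) = 0\<close> nonpositive, so
  that \<open>\<nabla>u(x) = 0\<close> (\<open>vec_zero_of_max_nonpos\<close>). The gradient of \<open>v\<close> has the same extrema and
  vanishes too. Consequently every neighbor of \<open>x\<close> is again in \<open>B\<close>. A nonempty set that is closed
  under passing to neighbors meets the boundary of a graph connected to it, while \<open>B\<close> does not.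
\<close>

section \<open>Extremal components of vectors\<close>

lemma vec_max_upper: "t \<in> set p \<Longrightarrow> t \<le> vec_max p"
  by (simp add: vec_max_def)

lemma vec_min_lower: "t \<in> set p \<Longrightarrow> vec_min p \<le> t"
  by (simp add: vec_min_def)

lemma vec_max_in_set: "p \<noteq> [] \<Longrightarrow> vec_max p \<in> set p"
  by (simp add: vec_max_def)

lemma vec_min_in_set: "p \<noteq> [] \<Longrightarrow> vec_min p \<in> set p"
  by (simp add: vec_min_def)

lemma vec_max_mono:
  assumes "list_all2 (\<le>) p q" and "p \<noteq> []"
  shows "vec_max p \<le> vec_max q"
proof -
  obtain i where "i < length p" "p ! i = vec_max p"
    using vec_max_in_set[OF assms(2)] by (auto simp: in_set_conv_nth)
  moreover from this have "p ! i \<le> q ! i" "q ! i \<in> set q"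
    using assms(1) by (auto simp: list_all2_conv_all_nth)
  ultimately show ?thesis
    using vec_max_upper[of "q ! i" q] by linarith
qed

lemma vec_min_mono:
  assumes "list_all2 (\<le>) p q" and "p \<noteq> []"
  shows "vec_min p \<le> vec_min q"
proof -
  have "q \<noteq> []"
    using assms by auto
  then obtain i where "i < length q" "q ! i = vec_min q"
    using vec_min_in_set by (metis in_set_conv_nth)
  moreover from this have "p ! i \<le> q ! i" "p ! i \<in> set p"
    using assms(1) by (auto simp: list_all2_conv_all_nth)
  ultimately show ?thesis
    using vec_min_lower[of "p ! i" p] by linarith
qed

text \<open>
  The left-hand sides of the two equations are compared term by term. A strict inequality between
  the maxima, or between the minima, would survive multiplication by the positive weight and make
  the left-hand sides differ. The numbers \<open>c\<close> and \<open>d\<close> stand for the values of \<open>f\<close>.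
\<close>

lemma vec_extrema_eq_of_le:
  fixes a b c d :: real
  assumes "list_all2 (\<le>) p q" and "p \<noteq> []" and "a > 0" and "b > 0" and "c \<le> d"
    and "a * vec_max p + b * vec_min p + c = 0"
    and "a * vec_max q + b * vec_min q + d = 0"
  shows "vec_max p = vec_max q" and "vec_min p = vec_min q"
proof -
  have le: "vec_max p \<le> vec_max q" "vec_min p \<le> vec_min q"
    using vec_max_mono vec_min_mono assms(1,2) by blast+
  then have "a * vec_max p \<le> a * vec_max q" "b * vec_min p \<le> b * vec_min q"
    using assms(3,4) by auto
  then have "a * vec_max p = a * vec_max q" "b * vec_min p = b * vec_min q"
    using assms(5-7) by linarith+
  then show "vec_max p = vec_max q" "vec_min p = vec_min q"
    using assms(3,4) by auto
qed

text \<open>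
  A sum of three nonpositive terms vanishes only if each of them does; the upper homogeneity bound
  is what gives the third term \<open>c\<close> its sign.
\<close>

lemma vec_zero_of_max_nonpos:
  fixes a b c k :: real
  assumes "p \<noteq> []" and "a > 0" and "b > 0" and "k \<ge> 0" and "c \<le> k * vec_max p"
    and "a * vec_max p + b * vec_min p + c = 0"
    and "vec_max p \<le> 0"
  shows "vec_max p = 0" and "vec_min p = 0"
proof -
  have "vec_min p \<le> 0"
    using vec_max_upper[OF vec_min_in_set[OF assms(1)]] assms(7) by linarith
  then have "a * vec_max p \<le> 0" "b * vec_min p \<le> 0" "k * vec_max p \<le> 0"
    using assms(2-4,7) by (auto simp: mult_le_0_iff)
  then have "a * vec_max p = 0" "b * vec_min p = 0"
    using assms(5,6) by linarith+
  then show "vec_max p = 0" "vec_min p = 0"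
    using assms(2,3) by auto
qed

section \<open>Neighbors and connection to the boundary\<close>

lemma neighbor_closed_set_meets_boundary:
  assumes "connected_to_boundary G bd" and "x \<in> pverts G" and "x \<in> B"
    and closed: "\<And>a b. a \<in> B \<Longrightarrow> b \<in> neighbors G a \<Longrightarrow> b \<in> B"
  shows "B \<inter> bd \<noteq> {}"
proof -
  obtain y where "y \<in> bd" and path: "(\<lambda>a b. b \<in> neighbors G a)\<^sup>*\<^sup>* x y"
    using assms(1,2) unfolding connected_to_boundary_def by blast
  from path \<open>x \<in> B\<close> have "y \<in> B"
    by (induction rule: rtranclp_induct) (auto intro: closed)
  with \<open>y \<in> bd\<close> show ?thesis
    by blast
qed

context weighted_digraph_with_boundary
begin

lemma neighbor_in_pverts: "y \<in> neighbors G x \<Longrightarrow> y \<in> pverts G"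
  unfolding neighbors_def using in_arcsD2 by auto

lemma weight_neighbor_pos: "y \<in> neighbors G x \<Longrightarrow> w x y > 0"
  unfolding neighbors_def using weight_pos by auto

lemma length_gradient: "x \<in> pverts G \<Longrightarrow> length (gradient w nbrs u x) = degree G x"
  unfolding gradient_def degree_def
  using distinct_nbrs set_nbrs by (metis distinct_card length_map)

lemma set_gradient:
  "x \<in> pverts G \<Longrightarrow> set (gradient w nbrs u x) = (\<lambda>y. w x y * (u y - u x)) ` neighbors G x"
  unfolding gradient_def using set_nbrs by simp

lemma gradient_nonempty:
  assumes "x \<in> interior_vertices G bd"
  shows "gradient w nbrs u x \<noteq> []"
  using degree_ge_1[OF assms] length_gradient[of x u] assms
  by (auto simp: interior_vertices_def)

lemma neighbor_eq_of_gradient_extrema_zero: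
  assumes "x \<in> pverts G" and "y \<in> neighbors G x"
    and "vec_max (gradient w nbrs u x) = 0" and "vec_min (gradient w nbrs u x) = 0"
  shows "u y = u x"
proof -
  have "w x y * (u y - u x) \<in> set (gradient w nbrs u x)"
    using assms(1,2) by (simp add: set_gradient)
  then have "w x y * (u y - u x) = 0"
    using vec_max_upper vec_min_lower assms(3,4) by fastforce
  then show ?thesis
    using weight_neighbor_pos[OF assms(2)] by simp
qed

section \<open>Vertices where the difference of two functions is maximal\<close>

lemma gradient_le_at_max_difference:
  assumes "x \<in> pverts G" and max: "\<And>y. y \<in> pverts G \<Longrightarrow> u y - v y \<le> u x - v x"
  shows "list_all2 (\<le>) (gradient w nbrs u x) (gradient w nbrs v x)"
proof -
  have "w x y * (u y - u x) \<le> w x y * (v y - v x)" if "y \<in> set (nbrs x)" for y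
  proof -
    have y: "y \<in> neighbors G x"
      using that set_nbrs assms(1) by simp
    show ?thesis
      using max[OF neighbor_in_pverts[OF y]] weight_neighbor_pos[OF y]
      by (intro mult_left_mono) auto
  qed
  then show ?thesis
    by (auto simp: gradient_def list_all2_conv_all_nth)
qed

text \<open>
  A neighbor in the direction of steepest ascent of \<open>u\<close> works: the common value of the two maxima
  bounds the increment of \<open>v\<close> along that edge from above by the increment of \<open>u\<close>.
\<close>

lemma steepest_ascent_keeps_difference:
  assumes "x \<in> interior_vertices G bd"
    and "vec_max (gradient w nbrs u x) = vec_max (gradient w nbrs v x)"
  obtains y where "y \<in> neighbors G x" and "u x - v x \<le> u y - v y"
    and "vec_max (gradient w nbrs u x) = w x y * (u y - u x)"
proof -
  have x: "x \<in> pverts G"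
    using assms(1) by (simp add: interior_vertices_def)
  obtain y where y: "y \<in> neighbors G x"
    and eq: "vec_max (gradient w nbrs u x) = w x y * (u y - u x)"
    using vec_max_in_set[OF gradient_nonempty[OF assms(1)], of u] set_gradient[OF x] by auto
  have "w x y * (v y - v x) \<le> vec_max (gradient w nbrs v x)"
    using y x by (intro vec_max_upper) (simp add: set_gradient)
  then have "w x y * (v y - v x) \<le> w x y * (u y - u x)"
    using assms(2) eq by simp
  then have "u x - v x \<le> u y - v y"
    using weight_neighbor_pos[OF y] by simp
  then show ?thesis
    using that y eq by blast
qed

end

section \<open>The comparison principle\<close>

theorem theorem4:
  fixes G :: "'v pair_pre_digraph"
    and w :: "'v \<Rightarrow> 'v \<Rightarrow> real"
    and bd :: "'v set"
    and nbrs :: "'v \<Rightarrow> 'v list"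
    and F :: "('v \<Rightarrow> real) \<Rightarrow> 'v \<Rightarrow> real"
    and w_plus w_minus :: "'v \<Rightarrow> real"
    and f :: "'v \<Rightarrow> real list \<Rightarrow> real"
    and u v :: "'v \<Rightarrow> real"
  assumes "weighted_digraph_with_boundary G w bd nbrs"
    and "connected_to_boundary G bd"
    and "\<And>x. x \<in> interior_vertices G bd \<Longrightarrow> w_plus x > 0"
    and "\<And>x. x \<in> interior_vertices G bd \<Longrightarrow> w_minus x > 0"
    and "elliptic G bd f"
    and "homogeneous G bd f"
    and "\<And>u x. x \<in> interior_vertices G bd \<Longrightarrow>
           F u x = w_plus x * vec_max (gradient w nbrs u x)
                 + w_minus x * vec_min (gradient w nbrs u x)
                 + f x (gradient w nbrs u x)"
    and "\<And>x. x \<in> interior_vertices G bd \<Longrightarrow> F u x = 0"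
    and "\<And>x. x \<in> interior_vertices G bd \<Longrightarrow> F v x = 0"
    and "\<And>x. x \<in> bd \<Longrightarrow> u x \<le> v x"
  shows "\<forall>x\<in>pverts G. u x \<le> v x"
proof -
  interpret weighted_digraph_with_boundary G w bd nbrs
    by (fact assms(1))
  let ?du = "\<lambda>x. gradient w nbrs u x" and ?dv = "\<lambda>x. gradient w nbrs v x"
  obtain w0 :: "'v \<Rightarrow> real"
    where w0: "\<And>x. x \<in> interior_vertices G bd \<Longrightarrow> w0 x \<ge> 0"
    "\<And>x p. x \<in> interior_vertices G bd \<Longrightarrow> length p = degree G x \<Longrightarrow>
       f x p \<le> w0 x * vec_max p"
    using assms(6) unfolding homogeneous_def by blast
  have "pverts G \<noteq> {}"
    using boundary_subset boundary_nonempty by auto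
  define M where "M = Max ((\<lambda>x. u x - v x) ` pverts G)"
  have M_upper: "u x - v x \<le> M" if "x \<in> pverts G" for x
    unfolding M_def using that by (intro Max_ge) auto
  have "M \<le> 0"
  proof (rule ccontr)
    assume "\<not> M \<le> 0"
    define A where "A = {x \<in> pverts G. u x - v x = M}"
    have "M \<in> (\<lambda>x. u x - v x) ` pverts G"
      unfolding M_def using \<open>pverts G \<noteq> {}\<close> by (intro Max_in) auto
    then have "A \<noteq> {}"
      unfolding A_def by auto
    have "finite A"
      unfolding A_def by simp
    have A_interior: "x \<in> interior_vertices G bd" if "x \<in> A" for x
      using that assms(10)[of x] \<open>\<not> M \<le> 0\<close>
      by (auto simp: A_def interior_vertices_def)
    have extrema: "vec_max (?du x) = vec_max (?dv x)" "vec_min (?du x) = vec_min (?dv x)"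
      if "x \<in> A" for x
    proof -
      have int: "x \<in> interior_vertices G bd" and x: "x \<in> pverts G"
        using A_interior that by (auto simp: A_def)
      have le: "list_all2 (\<le>) (?du x) (?dv x)"
        using x M_upper that by (intro gradient_le_at_max_difference) (auto simp: A_def)
      have "f x (?du x) \<le> f x (?dv x)"
        using assms(5) int le x by (simp add: elliptic_def length_gradient)
      moreover have
        "w_plus x * vec_max (?du x) + w_minus x * vec_min (?du x) + f x (?du x) = 0"
        "w_plus x * vec_max (?dv x) + w_minus x * vec_min (?dv x) + f x (?dv x) = 0"
        using assms(7)[OF int, of u] assms(7)[OF int, of v] assms(8)[OF int] assms(9)[OF int]
        by simp_all
      ultimately show "vec_max (?du x) = vec_max (?dv x)" "vec_min (?du x) = vec_min (?dv x)"
        using vec_extrema_eq_of_le[OF le gradient_nonempty[OF int]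
            assms(3)[OF int] assms(4)[OF int]] by blast+
    qed
    define B where "B = {x \<in> A. u x = Max (u ` A)}"
    have "Max (u ` A) \<in> u ` A"
      using \<open>finite A\<close> \<open>A \<noteq> {}\<close> by (intro Max_in) auto
    then obtain x0 where "x0 \<in> B"
      unfolding B_def by auto
    have B_closed: "y \<in> B" if "x \<in> B" and y: "y \<in> neighbors G x" for x y
    proof -
      have "x \<in> A"
        using \<open>x \<in> B\<close> by (simp add: B_def)
      have top: "u z \<le> u x" if "z \<in> A" for z
        using \<open>x \<in> B\<close> \<open>finite A\<close> that by (auto simp: B_def)
      have int: "x \<in> interior_vertices G bd" and x: "x \<in> pverts G"
        using A_interior \<open>x \<in> A\<close> by (auto simp: A_def)
      obtain z where z: "z \<in> neighbors G x" "u x - v x \<le> u z - v z"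
        and max_z: "vec_max (?du x) = w x z * (u z - u x)"
        using steepest_ascent_keeps_difference[OF int extrema(1)[OF \<open>x \<in> A\<close>]] .
      have "z \<in> A"
        using z(2) M_upper[OF neighbor_in_pverts[OF z(1)]] neighbor_in_pverts[OF z(1)] \<open>x \<in> A\<close>
        by (simp add: A_def)
      then have "vec_max (?du x) \<le> 0"
        using top weight_neighbor_pos[OF z(1)] max_z by (simp add: mult_le_0_iff)
      moreover have
        "w_plus x * vec_max (?du x) + w_minus x * vec_min (?du x) + f x (?du x) = 0"
        using assms(7)[OF int, of u] assms(8)[OF int] by simp
      ultimately have u_zero: "vec_max (?du x) = 0" "vec_min (?du x) = 0"
        using vec_zero_of_max_nonpos[OF gradient_nonempty[OF int] assms(3)[OF int]
            assms(4)[OF int] w0(1)[OF int] w0(2)[OF int length_gradient[OF x]]] by blast+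
      have "u y = u x"
        using neighbor_eq_of_gradient_extrema_zero[OF x y u_zero] .
      moreover have "v y = v x"
        using u_zero extrema[OF \<open>x \<in> A\<close>]
        by (intro neighbor_eq_of_gradient_extrema_zero[OF x y]) simp_all
      ultimately show "y \<in> B"
        using \<open>x \<in> B\<close> neighbor_in_pverts[OF y] by (simp add: B_def A_def)
    qed
    have "x0 \<in> pverts G"
      using \<open>x0 \<in> B\<close> by (simp add: B_def A_def)
    then have "B \<inter> bd \<noteq> {}"
      using B_closed by (rule neighbor_closed_set_meets_boundary[OF assms(2) _ \<open>x0 \<in> B\<close>])
    moreover have "B \<inter> bd = {}"
      using A_interior by (auto simp: B_def interior_vertices_def)
    ultimately show False
      by blast
  qed
  then show ?thesis
    using M_upper by fastforce
qed

end
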